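(* Let $A:[0,\infty)\to\mathbb{R}^{n\times n}$ be continuous and let $g:[0,\infty)\times\mathbb{R}^n\to\mathbb{R}^n$ satisfy $g(t,0)=0$ for all $t\ge 0$. Assume that the nominal linear system $\dot x=A(t)x$ is uniformly asymptotically stable, and let $c>0$, $\gamma>0$ be constants such that its state transition matrix satisfies $\|R(t,t_0)\|\le c\,e^{-\gamma(t-t_0)}$ for all $t\ge t_0\ge 0$. Suppose there exist $p\in[1,\infty)$ and a function $\phi\in L^p([0,\infty),[0,\infty))$ such that $$\|g(t,x)\|\le \phi(t)\,\|x\|\qquad\text{for all }(t,x)\in[0,\infty)\times\mathbb{R}^n.$$ Then the perturbed system $$\dot x=A(t)x+g(t,x),\qquad x(t_0)=x_0,$$ is globally uniformly exponentially stable. The same conclusion holds when $p=\infty$ (that is, $\phi\in L^\infty([0,\infty),[0,\infty))$ with the same bound on $g$) under the additional condition $\|\phi\|_\infty<\gamma/c$.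
   Context: $\|\cdot\|$ denotes a fixed norm on $\mathbb{R}^n$ and also the induced operator norm on $\mathbb{R}^{n\times n}$. $R(t,t_0)$ is the state transition matrix of $\dot x=A(t)x$, i.e. $\partial_t R(t,t_0)=A(t)R(t,t_0)$, $R(t_0,t_0)=I$. The linear system $\dot x=A(t)x$ is uniformly asymptotically stable if and only if there exist constants $c>0$, $\gamma>0$ such that $\|R(t,t_0)\|\le c\,e^{-\gamma(t-t_0)}$ for all $t\ge t_0\ge 0$. Solutions. For $t_0\ge0$ and $x_0\in\mathbb{R}^n$, a solution of $\dot x=A(t)x+g(t,x)$, $x(t_0)=x_0$ on $[t_0,T)$, $t_0<T\le\infty$, is a continuous function $x:[t_0,T)\to\mathbb{R}^n$ such that $s\mapsto g(s,x(s))$ is locally integrable on $[t_0,T)$ and $x(t)=x_0+\int_{t_0}^t\big(A(s)x(s)+g(s,x(s))\big)ds$ for all $t\in[t_0,T)$. It is non-continuable if it is not the restriction of a solution on $[t_0,T')$ with $T'>T$. It is assumed that $g$ is regular enough for the usual continuation property to hold: every non-continuable solution on $[t_0,T)$ with $T<\infty$ is unbounded on $[t_0,T)$ (this is automatic, for instance, if $g$ is continuous). The perturbed system (equivalently, its equilibrium point $x^*=0$) is globally uniformly exponentially stable if there exist constants $C>0$ and $\mu>0$ such that for all $t_0\ge0$ and all $x_0\in\mathbb{R}^n$, every non-continuable solution with $x(t_0)=x_0$ is defined on $[t_0,\infty)$ and satisfies $\|x(t)\|\le C\|x_0\|e^{-\mu(t-t_0)}$ for all $t\ge t_0$. *)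

theory Defs
  imports "HOL-Analysis.Analysis" "HOL-Probability.Essential_Supremum"
begin

text \<open>
  Functions on \<open>[0,\<infinity>)\<close> are total functions on \<^typ>\<open>real\<close> whose values at negative times are
  never used. The norm on the state space is an arbitrary one, not the Euclidean norm of the
  type class.
\<close>

definition is_norm :: "('a::real_vector \<Rightarrow> real) \<Rightarrow> bool" where
  "is_norm N \<longleftrightarrow>
     (\<forall>x. 0 \<le> N x) \<and>
     (\<forall>x. N x = 0 \<longleftrightarrow> x = 0) \<and>
     (\<forall>a x. N (a *\<^sub>R x) = \<bar>a\<bar> * N x) \<and>
     (\<forall>x y. N (x + y) \<le> N x + N y)"

text \<open>As in \<^const>\<open>onorm\<close>, the point \<open>x = 0\<close> contributes \<open>0 / 0 = 0\<close>.\<close>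

definition induced_norm :: "(real^'n \<Rightarrow> real) \<Rightarrow> real^'n^'n \<Rightarrow> real" where
  "induced_norm N M = (SUP x. N (M *v x) / N x)"

definition transition_matrix ::
  "(real \<Rightarrow> real^'n^'n) \<Rightarrow> (real \<Rightarrow> real \<Rightarrow> real^'n^'n) \<Rightarrow> bool" where
  "transition_matrix A R \<longleftrightarrow>
     (\<forall>t0\<ge>0. R t0 t0 = mat 1 \<and>
        (\<forall>t\<ge>0. ((\<lambda>s. R s t0) has_vector_derivative A t ** R t t0) (at t within {0..})))"

text \<open>The interval \<open>[t0,T)\<close>, where \<open>T\<close> may be \<open>\<infinity>\<close>.\<close>

definition time_interval :: "real \<Rightarrow> ereal \<Rightarrow> real set" where
  "time_interval t0 T = {t. t0 \<le> t \<and> ereal t < T}"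

text \<open>
  Solutions of \<open>x' = A(t) x + g(t,x)\<close>, \<open>x(t0) = x0\<close> on \<open>[t0,T)\<close> in integrated form. Local
  integrability is in the sense of Lebesgue, i.e. absolute Henstock-Kurzweil integrability on
  the compact subintervals \<open>[t0,t]\<close>.
\<close>

definition is_solution ::
  "(real \<Rightarrow> real^'n^'n) \<Rightarrow> (real \<Rightarrow> real^'n \<Rightarrow> real^'n) \<Rightarrow>
   real \<Rightarrow> real^'n \<Rightarrow> ereal \<Rightarrow> (real \<Rightarrow> real^'n) \<Rightarrow> bool" where
  "is_solution A g t0 x0 T x \<longleftrightarrow>
     ereal t0 < T \<and>
     continuous_on (time_interval t0 T) x \<and>
     (\<forall>t\<in>time_interval t0 T. (\<lambda>s. g s (x s)) absolutely_integrable_on {t0..t}) \<and>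
     (\<forall>t\<in>time_interval t0 T. x t = x0 + integral {t0..t} (\<lambda>s. A s *v x s + g s (x s)))"

definition noncontinuable_solution ::
  "(real \<Rightarrow> real^'n^'n) \<Rightarrow> (real \<Rightarrow> real^'n \<Rightarrow> real^'n) \<Rightarrow>
   real \<Rightarrow> real^'n \<Rightarrow> ereal \<Rightarrow> (real \<Rightarrow> real^'n) \<Rightarrow> bool" where
  "noncontinuable_solution A g t0 x0 T x \<longleftrightarrow>
     is_solution A g t0 x0 T x \<and>
     \<not> (\<exists>T' y. T < T' \<and> is_solution A g t0 x0 T' y \<and> (\<forall>t\<in>time_interval t0 T. y t = x t))"

definition continuation_property ::
  "(real \<Rightarrow> real^'n^'n) \<Rightarrow> (real \<Rightarrow> real^'n \<Rightarrow> real^'n) \<Rightarrow> bool" where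
  "continuation_property A g \<longleftrightarrow>
     (\<forall>t0\<ge>0. \<forall>x0 T x. noncontinuable_solution A g t0 x0 T x \<and> T < \<infinity> \<longrightarrow>
        \<not> bounded (x ` time_interval t0 T))"

text \<open>
  Uniform asymptotic stability of \<open>x' = A(t) x\<close> in the sense of Lyapunov: uniform stability
  together with uniform attractivity of the origin.
\<close>

definition uniformly_asymptotically_stable ::
  "(real^'n \<Rightarrow> real) \<Rightarrow> (real \<Rightarrow> real^'n^'n) \<Rightarrow> bool" where
  "uniformly_asymptotically_stable N A \<longleftrightarrow>
     (\<forall>\<epsilon>>0. \<exists>\<delta>>0. \<forall>t0\<ge>0. \<forall>x0 x.
        is_solution A (\<lambda>t x. 0) t0 x0 \<infinity> x \<and> N x0 < \<delta> \<longrightarrow> (\<forall>t\<ge>t0. N (x t) < \<epsilon>)) \<and>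
     (\<exists>\<delta>>0. \<forall>\<epsilon>>0. \<exists>\<tau>>0. \<forall>t0\<ge>0. \<forall>x0 x.
        is_solution A (\<lambda>t x. 0) t0 x0 \<infinity> x \<and> N x0 < \<delta> \<longrightarrow> (\<forall>t\<ge>t0 + \<tau>. N (x t) < \<epsilon>))"

definition globally_uniformly_exponentially_stable ::
  "(real^'n \<Rightarrow> real) \<Rightarrow> (real \<Rightarrow> real^'n^'n) \<Rightarrow> (real \<Rightarrow> real^'n \<Rightarrow> real^'n) \<Rightarrow> bool" where
  "globally_uniformly_exponentially_stable N A g \<longleftrightarrow>
     (\<exists>C>0. \<exists>\<mu>>0. \<forall>t0\<ge>0. \<forall>x0 T x. noncontinuable_solution A g t0 x0 T x \<longrightarrow>
        T = \<infinity> \<and> (\<forall>t\<ge>t0. N (x t) \<le> C * N x0 * exp (- \<mu> * (t - t0))))"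

text \<open>\<open>\<phi> \<in> L\<^sup>p([0,\<infinity>),[0,\<infinity>))\<close> for finite \<open>p\<close>, for a function rather than an a.e.-class.\<close>

definition Lp_nonneg :: "real \<Rightarrow> (real \<Rightarrow> real) \<Rightarrow> bool" where
  "Lp_nonneg p \<phi> \<longleftrightarrow>
     \<phi> \<in> borel_measurable (lebesgue_on {0..}) \<and> (\<forall>t\<ge>0. 0 \<le> \<phi> t) \<and>
     integrable (lebesgue_on {0..}) (\<lambda>t. \<bar>\<phi> t\<bar> powr p)"

definition Linf_norm :: "(real \<Rightarrow> real) \<Rightarrow> ereal" where
  "Linf_norm \<phi> = esssup (lebesgue_on {0..}) (\<lambda>t. ereal \<bar>\<phi> t\<bar>)"

definition Linf_nonneg :: "(real \<Rightarrow> real) \<Rightarrow> bool" where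
  "Linf_nonneg \<phi> \<longleftrightarrow>
     \<phi> \<in> borel_measurable (lebesgue_on {0..}) \<and> (\<forall>t\<ge>0. 0 \<le> \<phi> t) \<and> Linf_norm \<phi> < \<infinity>"

end

theory Submission
  imports Defs
begin

text \<open>
  By variation of constants, \<open>u t = exp (\<gamma> (t - t0)) N (x t)\<close> satisfies
  \<open>u t \<le> c N x0 + \<integral> c \<phi> u\<close> over \<open>[t0,t]\<close>, so Gronwall's inequality gives
  \<open>u t \<le> c N x0 exp (c \<integral> \<phi>)\<close>. It remains that \<open>\<integral> \<phi> \<le> M + \<epsilon> (t - t0)\<close> for some
  \<open>\<epsilon> < \<gamma> / c\<close>: clear for small \<open>\<parallel>\<phi>\<parallel>\<^sub>\<infinity>\<close>, and for finite \<open>p\<close> a consequence of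
  \<open>\<phi> \<le> \<epsilon> powr (1 - p) * \<phi> powr p + \<epsilon>\<close> for any \<open>\<epsilon> > 0\<close>. Solutions and Gronwall majorants are
  only absolutely continuous, so both steps argue with increments over short intervals instead
  of derivatives.
\<close>

subsection \<open>Arbitrary norms\<close>

lemma is_norm_norm: "is_norm (norm :: 'b::real_normed_vector \<Rightarrow> real)"
  unfolding is_norm_def by (auto simp: norm_triangle_ineq)

context
  fixes N :: "'a::euclidean_space \<Rightarrow> real"
  assumes N: "is_norm N"
begin

lemma is_norm_nonneg: "0 \<le> N x"
  and is_norm_zero_iff: "N x = 0 \<longleftrightarrow> x = 0"
  and is_norm_scaleR: "N (r *\<^sub>R x) = \<bar>r\<bar> * N x"
  and is_norm_triangle: "N (x + y) \<le> N x + N y"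
  using N unfolding is_norm_def by auto

lemma is_norm_zero: "N 0 = 0"
  by (simp add: is_norm_zero_iff)

lemma is_norm_minus_commute: "N (x - y) = N (y - x)"
  using is_norm_scaleR[of "-1" "x - y"] by simp

lemma is_norm_sum: "N (sum f I) \<le> (\<Sum>i\<in>I. N (f i))"
proof (induction I rule: infinite_finite_induct)
  case (insert i I)
  then show ?case
    using is_norm_triangle[of "f i" "sum f I"] by simp
qed (simp_all add: is_norm_zero)

text \<open>Half of the equivalence of norms in finite dimension: the triangle inequality is applied
  to the expansion in \<open>Basis\<close>, where each coordinate is at most
  \<open>norm x\<close>.\<close>

lemma is_norm_upper_bound: "\<exists>C>0. \<forall>x. N x \<le> C * norm x"
proof (intro exI conjI allI)
  let ?C = "(\<Sum>b\<in>Basis. N b) + 1"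
  show "?C > 0"
    using sum_nonneg[of Basis N] is_norm_nonneg by fastforce
  fix x :: 'a
  have "N x = N (\<Sum>b\<in>Basis. (x \<bullet> b) *\<^sub>R b)"
    by (simp add: euclidean_representation)
  also have "\<dots> \<le> (\<Sum>b\<in>Basis. \<bar>x \<bullet> b\<bar> * N b)"
    using is_norm_sum[of "\<lambda>b. (x \<bullet> b) *\<^sub>R b" Basis] by (simp add: is_norm_scaleR)
  also have "\<dots> \<le> (\<Sum>b\<in>Basis. norm x * N b)"
    by (intro sum_mono mult_right_mono Basis_le_norm is_norm_nonneg)
  also have "\<dots> \<le> ?C * norm x"
    by (simp add: sum_distrib_left algebra_simps)
  finally show "N x \<le> ?C * norm x" .
qed

lemma is_norm_continuous_on: "continuous_on S N"
proof -
  obtain C where C: "C > 0" "\<And>x. N x \<le> C * norm x"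
    using is_norm_upper_bound by blast
  have "\<bar>N x - N y\<bar> \<le> C * dist x y" for x y
    using is_norm_triangle[of "x - y" y] is_norm_triangle[of "y - x" x] C(2)[of "x - y"]
    by (simp add: is_norm_minus_commute[of x y] dist_norm)
  then have "C-lipschitz_on S N"
    using C(1) by (intro lipschitz_onI) (auto simp: dist_real_def)
  then show ?thesis
    by (rule lipschitz_on_continuous_on)
qed

text \<open>The other half, by compactness: on the Euclidean unit sphere \<open>N\<close> attains a
  minimum, which is positive by definiteness, and homogeneity carries the bound to all
  vectors.\<close>

lemma is_norm_lower_bound: "\<exists>C>0. \<forall>x. norm x \<le> C * N x"
proof -
  have "compact (sphere 0 1 :: 'a set)" "sphere 0 1 \<noteq> ({} :: 'a set)"
    by auto
  then obtain z where z: "z \<in> sphere 0 1" "\<And>y. y \<in> sphere 0 1 \<Longrightarrow> N z \<le> N y"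
    using continuous_attains_inf[OF _ _ is_norm_continuous_on] by metis
  have pos: "N z > 0"
    using z(1) is_norm_nonneg[of z] is_norm_zero_iff[of z] by force
  have "norm x \<le> 1 / N z * N x" for x
  proof (cases "x = 0")
    case False
    then have "N z \<le> N ((1 / norm x) *\<^sub>R x)"
      by (intro z(2)) simp
    with False pos show ?thesis
      by (simp add: is_norm_scaleR field_simps)
  qed (simp add: is_norm_zero)
  with pos show ?thesis
    by (intro exI[of _ "1 / N z"]) auto
qed

text \<open>The bound passes to the integral from the Riemann sums, where it is the triangle inequality.\<close>

lemma is_norm_integral_le:
  fixes f :: "real \<Rightarrow> 'a"
  assumes f: "f integrable_on {a..b}" and k: "k integrable_on {a..b}"
    and le: "\<And>s. s \<in> {a..b} \<Longrightarrow> N (f s) \<le> k s"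
  shows "N (integral {a..b} f) \<le> integral {a..b} k"
proof (rule field_le_epsilon)
  fix e :: real
  assume e: "e > 0"
  let ?I = "integral {a..b} f" and ?J = "integral {a..b} k"
  obtain C where C: "C > 0" "\<And>x. N x \<le> C * norm x"
    using is_norm_upper_bound by blast
  \<comment> \<open>Each Riemann sum may cost half of \<open>e\<close>. The sum for \<open>f\<close>
    is controlled in the Euclidean norm, and passing to \<open>N\<close> costs the factor
    \<open>C\<close>.\<close>
  have "e / (2 * C) > 0" "e / 2 > 0"
    using e C by auto
  then obtain g1 g2 where g: "gauge g1" "gauge g2"
    and g1: "\<And>\<D>. \<D> tagged_division_of {a..b} \<Longrightarrow> g1 fine \<D> \<Longrightarrow>
        norm ((\<Sum>(x,K)\<in>\<D>. measure lborel K *\<^sub>R f x) - ?I) < e / (2 * C)"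
    and g2: "\<And>\<D>. \<D> tagged_division_of {a..b} \<Longrightarrow> g2 fine \<D> \<Longrightarrow>
        norm ((\<Sum>(x,K)\<in>\<D>. measure lborel K *\<^sub>R k x) - ?J) < e / 2"
    using f k unfolding has_integral_integral has_integral_real by meson
  obtain \<D> where \<D>: "\<D> tagged_division_of {a..b}" "g1 fine \<D>" "g2 fine \<D>"
    using fine_division_exists_real[OF gauge_Int[OF g]] by (metis fine_Int)
  let ?S = "\<Sum>(x,K)\<in>\<D>. measure lborel K *\<^sub>R f x"
  have "N ?S \<le> (\<Sum>(x,K)\<in>\<D>. measure lborel K * N (f x))"
    using is_norm_sum[of "\<lambda>(x,K). measure lborel K *\<^sub>R f x" \<D>]
    by (simp add: case_prod_unfold is_norm_scaleR)
  also have "\<dots> \<le> (\<Sum>(x,K)\<in>\<D>. measure lborel K *\<^sub>R k x)"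
    using tag_in_interval[OF \<D>(1)] le
    by (intro sum_mono) (auto intro!: mult_left_mono)
  also have "\<dots> \<le> ?J + e / 2"
    using g2[OF \<D>(1,3)] unfolding real_norm_def by linarith
  finally have S: "N ?S \<le> ?J + e / 2" .
  have "N (?I - ?S) \<le> C * norm (?S - ?I)"
    using C(2)[of "?I - ?S"] by (simp add: norm_minus_commute)
  also have "\<dots> \<le> e / 2"
    using g1[OF \<D>(1,2)] C(1) by (simp add: field_simps)
  finally show "N ?I \<le> ?J + e"
    using S is_norm_triangle[of "?I - ?S" ?S] by simp
qed

end

section \<open>Matrix-vector products and the induced norm\<close>

lemma bounded_bilinear_matrix_vector_mult:
  "bounded_bilinear ((*v) :: real^'n^'m \<Rightarrow> real^'n \<Rightarrow> real^'m)"
  unfolding bilinear_conv_bounded_bilinear[symmetric] bilinear_def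
  by (auto intro!: linearI simp: matrix_vector_mult_add_rdistrib matrix_vector_right_distrib
      scaleR_matrix_vector_assoc matrix_vector_mult_scaleR)

text \<open>This keeps the quotients in \<open>induced_norm\<close> bounded above, without which
  their real supremum would carry no information.\<close>

lemma is_norm_matrix_vector_bound:
  fixes N :: "real^'n \<Rightarrow> real"
  assumes N: "is_norm N"
  shows "\<exists>C>0. \<forall>M v. N (M *v v) \<le> C * norm M * N v"
proof -
  obtain C where C: "C > 0" "\<And>x. N x \<le> C * norm x"
    using is_norm_upper_bound[OF N] by blast
  obtain D where D: "D > 0" "\<And>x. norm x \<le> D * N x"
    using is_norm_lower_bound[OF N] by blast
  obtain K where K: "K > 0" "\<And>(M :: real^'n^'n) v. norm (M *v v) \<le> norm M * norm v * K"
    using bounded_bilinear.pos_bounded[OF bounded_bilinear_matrix_vector_mult] by blast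
  have "N (M *v v) \<le> (C * K * D) * norm M * N v" for M v
  proof -
    have "N (M *v v) \<le> C * (norm M * norm v * K)"
      using C K(2)[of M v] by (meson mult_left_mono order.trans less_imp_le)
    also have "\<dots> \<le> C * (norm M * (D * N v) * K)"
      using C(1) K(1) D(2)[of v] by (intro mult_left_mono mult_right_mono) auto
    finally show ?thesis
      by (simp add: mult_ac)
  qed
  then show ?thesis
    using C(1) D(1) K(1) by (intro exI[of _ "C * K * D"]) auto
qed

lemma induced_norm_bound:
  fixes N :: "real^'n \<Rightarrow> real"
  assumes N: "is_norm N"
  shows "N (M *v v) \<le> induced_norm N M * N v"
proof (cases "v = 0")
  case False
  then have pos: "N v > 0"
    using is_norm_nonneg[OF N, of v] is_norm_zero_iff[OF N, of v] by force
  obtain C where "C > 0" "\<And>v. N (M *v v) \<le> C * norm M * N v"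
    using is_norm_matrix_vector_bound[OF N] by blast
  \<comment> \<open>At \<open>N x = 0\<close> the quotient is \<open>0\<close> by the convention on
    division, so the bound covers the origin too.\<close>
  then have "N (M *v x) / N x \<le> C * norm M" for x
    using is_norm_nonneg[OF N, of x] by (cases "N x = 0") (auto simp: divide_le_eq)
  then have "N (M *v v) / N v \<le> induced_norm N M"
    unfolding induced_norm_def by (intro cSUP_upper bdd_aboveI[of _ "C * norm M"]) auto
  with pos show ?thesis
    by (simp add: divide_le_eq)
qed (simp add: is_norm_zero[OF N])

subsection \<open>Gronwall's inequality with an integrable kernel\<close>

text \<open>Induction on the number of steps of length \<delta> needed to reach the right end. It
  takes the place of a sign condition on a derivative: the increment estimates below hold only
  across short intervals, with a length uniform in the position.\<close>

lemma locally_increasing_imp_le: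
  fixes f :: "real \<Rightarrow> real"
  assumes "\<delta> > 0" "a \<le> b"
    and step: "\<And>s t. a \<le> s \<Longrightarrow> s \<le> t \<Longrightarrow> t \<le> b \<Longrightarrow> t - s \<le> \<delta> \<Longrightarrow> f s \<le> f t"
  shows "f a \<le> f b"
proof -
  have *: "f a \<le> f t" if "a \<le> t" "t \<le> b" "t - a \<le> real n * \<delta>" for n t
    using that
  proof (induction n arbitrary: t)
    case (Suc n)
    \<comment> \<open>One step back, cut off at \<open>a\<close> so as not to leave the
      interval.\<close>
    let ?s = "max a (t - \<delta>)"
    have "f a \<le> f ?s"
      using Suc.prems \<open>\<delta> > 0\<close> by (intro Suc.IH) (auto simp: algebra_simps max_def)
    also have "f ?s \<le> f t"
      using Suc.prems \<open>\<delta> > 0\<close> by (intro step) auto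
    finally show ?case .
  qed simp
  obtain n where "(b - a) / \<delta> \<le> real n"
    using real_arch_simple by blast
  with *[of b n] assms show ?thesis
    by (simp add: divide_le_eq)
qed

lemma integral_diff_subinterval:
  fixes f :: "real \<Rightarrow> 'b::banach"
  assumes "f integrable_on {a..b}" "a \<le> s" "s \<le> t" "t \<le> b"
  shows "integral {a..t} f - integral {a..s} f = integral {s..t} f"
  using Henstock_Kurzweil_Integration.integral_combine[OF assms(2,3), of f] integrable_subinterval_real[OF assms(1), of a t] assms
  by (auto simp: algebra_simps)

text \<open>The inequality \<open>ln y \<le> y - 1\<close> at \<open>y = 1 / (1 - k)\<close> gives
  \<open>- ln (1 - k) \<le> k / (1 - k)\<close>, and the smallness of \<open>k\<close> says that
  \<open>1 / (1 - k) \<le> l\<close>.\<close>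

lemma ln_one_minus_ge:
  fixes k l :: real
  assumes "l > 1" "0 \<le> k" "k \<le> 1 - 1 / l"
  shows "- (l * k) \<le> ln (1 - k)"
proof -
  have inv: "1 / l \<le> 1 - k" "1 / l > 0"
    using assms by auto
  then have pos: "1 - k > 0"
    by linarith
  have "1 / (1 - k) \<le> l"
    using inv pos assms(1) by (simp add: field_simps)
  then have "k * (1 / (1 - k)) \<le> k * l"
    using assms(2) by (rule mult_left_mono)
  moreover have "ln (1 / (1 - k)) \<le> 1 / (1 - k) - 1"
    using pos by (intro ln_le_minus_one) simp
  moreover have "1 / (1 - k) - 1 = k * (1 / (1 - k))"
    using pos by (simp add: field_simps)
  ultimately show ?thesis
    using pos by (simp add: ln_div mult.commute)
qed

text \<open>Since the majorant \<open>G\<close> is only absolutely continuous, differentiation is replaced by the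
  increments: \<open>G t - G s \<le> \<kappa> * G t\<close> with \<open>\<kappa>\<close> the integral of the kernel over \<open>[s,t]\<close>, so
  \<open>ln G\<close> grows at most like \<open>- ln (1 - \<kappa>)\<close>, which is \<open>\<kappa>\<close> up to a factor close to 1.\<close>

lemma gronwall_integrable_kernel:
  fixes u k :: "real \<Rightarrow> real"
  assumes "a \<le> b" "0 \<le> \<alpha>"
    and k: "k integrable_on {a..b}" and ku: "(\<lambda>t. k t * u t) integrable_on {a..b}"
    and k0: "\<And>t. t \<in> {a..b} \<Longrightarrow> 0 \<le> k t" and u0: "\<And>t. t \<in> {a..b} \<Longrightarrow> 0 \<le> u t"
    and le: "\<And>t. t \<in> {a..b} \<Longrightarrow> u t \<le> \<alpha> + integral {a..t} (\<lambda>s. k s * u s)"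
  shows "u b \<le> \<alpha> * exp (integral {a..b} k)"
proof -
  define K where "K = (\<lambda>t. integral {a..t} k)"
  have cont: "uniformly_continuous_on {a..b} K"
    unfolding K_def by (intro compact_uniformly_continuous indefinite_integral_continuous_1 k) simp
  \<comment> \<open>Taking \<open>\<beta> > \<alpha>\<close> keeps the majorant \<open>G\<close>
    positive even for \<open>\<alpha> = 0\<close>, so that \<open>ln G\<close> makes sense;
    \<open>l > 1\<close> leaves room to replace \<open>- ln (1 - \<kappa>)\<close> by
    \<open>l * \<kappa>\<close>. Both slacks vanish in a final limit.\<close>
  have *: "u b \<le> \<beta> * exp (l * K b)" if \<beta>: "\<beta> > \<alpha>" and l: "l > 1" for \<beta> l
  proof -
    define G where "G = (\<lambda>t. \<beta> + integral {a..t} (\<lambda>s. k s * u s))"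
    have Gpos: "G t > 0" if "t \<in> {a..b}" for t
      using that \<beta> assms(2) k0 u0 unfolding G_def
      by (intro add_pos_nonneg integral_nonneg integrable_subinterval_real[OF ku]) auto
    have Gu: "u t \<le> G t" if "t \<in> {a..b}" for t
      using le[OF that] \<beta> unfolding G_def by simp
    have "1 - 1 / l > 0"
      using l by simp
    \<comment> \<open>Uniform continuity makes all increments of \<open>K\<close> over short
      intervals small enough for \<open>ln_one_minus_ge\<close>.\<close>
    then obtain \<delta> where \<delta>: "\<delta> > 0"
      "\<And>s t. s \<in> {a..b} \<Longrightarrow> t \<in> {a..b} \<Longrightarrow> dist t s < \<delta> \<Longrightarrow> dist (K t) (K s) < 1 - 1 / l"
      using cont unfolding uniformly_continuous_on_def by metis
    have "l * K a - ln (G a) \<le> l * K b - ln (G b)"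
    proof (rule locally_increasing_imp_le[where f = "\<lambda>t. l * K t - ln (G t)" and \<delta> = "\<delta> / 2"])
      fix s t
      assume st: "a \<le> s" "s \<le> t" "t \<le> b" "t - s \<le> \<delta> / 2"
      have int: "k integrable_on {s..t}" "(\<lambda>r. k r * u r) integrable_on {s..t}"
        using st integrable_subinterval_real[OF k, of s t] integrable_subinterval_real[OF ku, of s t]
        by auto
      have Kd: "K t - K s = integral {s..t} k"
        unfolding K_def using k st by (intro integral_diff_subinterval)
      also have "\<dots> \<ge> 0"
        using st k0 int by (intro integral_nonneg) auto
      finally have K0: "0 \<le> K t - K s" .
      have K1: "K t - K s \<le> 1 - 1 / l"
        using \<delta>(2)[of s t] \<delta>(1) st by (auto simp: dist_real_def)
      have "G t - G s = integral {s..t} (\<lambda>r. k r * u r)"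
        unfolding G_def using integral_diff_subinterval[OF ku] st by simp
      also have "\<dots> \<le> integral {s..t} (\<lambda>r. k r * G t)"
      proof (rule integral_le)
        fix r
        assume r: "r \<in> {s..t}"
        \<comment> \<open>\<open>G\<close> is nondecreasing, hence
          \<open>u r \<le> G r \<le> G t\<close>.\<close>
        have "G t - G r = integral {r..t} (\<lambda>r. k r * u r)"
          unfolding G_def using integral_diff_subinterval[OF ku] st r by simp
        also have "\<dots> \<ge> 0"
          using st r k0 u0 by (intro integral_nonneg integrable_subinterval_real[OF ku]) auto
        finally show "k r * u r \<le> k r * G t"
          using Gu[of r] k0[of r] st r by (intro mult_left_mono) auto
      qed (use int in \<open>auto intro: integrable_on_mult_left\<close>)
      also have "\<dots> = (K t - K s) * G t"
        using Kd by simp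
      finally have "G t * (1 - (K t - K s)) \<le> G s"
        by (simp add: algebra_simps)
      moreover have pos: "1 - (K t - K s) > 0"
      proof -
        have "1 / l > 0"
          using l by simp
        with K1 show ?thesis
          by linarith
      qed
      ultimately have "ln (G t * (1 - (K t - K s))) \<le> ln (G s)"
        using Gpos[of s] Gpos[of t] st by (subst ln_le_cancel_iff) auto
      moreover have "ln (G t * (1 - (K t - K s))) = ln (G t) + ln (1 - (K t - K s))"
        using Gpos[of t] pos st by (intro ln_mult_pos) auto
      ultimately show "l * K s - ln (G s) \<le> l * K t - ln (G t)"
        using ln_one_minus_ge[OF l K0 K1] by (simp add: algebra_simps)
    qed (use \<delta> assms(1) in auto)
    moreover have "K a = 0" "G a = \<beta>"
      by (simp_all add: K_def G_def)
    ultimately have "ln (G b) \<le> ln \<beta> + l * K b"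
      by simp
    then have "exp (ln (G b)) \<le> exp (ln \<beta> + l * K b)"
      by simp
    moreover have "0 < G b" "0 < \<beta>"
      using Gpos[of b] \<beta> assms(1,2) by auto
    ultimately have "G b \<le> \<beta> * exp (l * K b)"
      by (simp add: exp_add)
    with Gu[of b] assms(1) show ?thesis
      by simp
  qed
  \<comment> \<open>The slacks are removed with \<open>\<beta> = \<alpha> + e\<close> and
    \<open>l = 1 + e\<close> as \<open>e\<close> decreases to \<open>0\<close>.\<close>
  have "((\<lambda>e. (\<alpha> + e) * exp ((1 + e) * K b)) \<longlongrightarrow> (\<alpha> + 0) * exp ((1 + 0) * K b)) (at_right 0)"
    by (intro tendsto_intros)
  moreover have "\<forall>\<^sub>F e in at_right 0. u b \<le> (\<alpha> + e) * exp ((1 + e) * K b)"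
    unfolding eventually_at_right_field using * by (intro exI[of _ 1]) auto
  ultimately have "u b \<le> (\<alpha> + 0) * exp ((1 + 0) * K b)"
    by (rule tendsto_lowerbound) simp
  then show ?thesis
    by (simp add: K_def)
qed

subsection \<open>Forced linear equations\<close>

text \<open>Nonnegativity upgrades gauge integrability to absolute integrability, which survives
  multiplication by a bounded measurable function; plain gauge integrability need not.\<close>

lemma integrable_continuous_times_nonneg:
  fixes f k :: "real \<Rightarrow> real"
  assumes f: "continuous_on {a..b} f" and k: "k integrable_on {a..b}"
    and k0: "\<And>s. s \<in> {a..b} \<Longrightarrow> 0 \<le> k s"
  shows "(\<lambda>s. f s * k s) integrable_on {a..b}"
proof -
  have "k absolutely_integrable_on {a..b}"
    using k k0 by (intro nonnegative_absolutely_integrable_1)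
  moreover have "f \<in> borel_measurable (lebesgue_on {a..b})"
    using f by (intro continuous_imp_measurable_on_sets_lebesgue) auto
  moreover have "bounded (f ` {a..b})"
    using f by (intro compact_imp_bounded compact_continuous_image) auto
  ultimately have "(\<lambda>s. f s * k s) absolutely_integrable_on {a..b}"
    by (intro absolutely_integrable_bounded_measurable_product_real) auto
  then show ?thesis
    by (rule set_lebesgue_integral_eq_integral(1))
qed

text \<open>Gronwall with the constant kernel \<open>K\<close>, the total forcing over
  \<open>{a..b}\<close> serving as the additive constant. The factor in front of the forcing tends
  to 1 as the interval shrinks, which is what adding up over many short intervals requires.\<close>

lemma forced_linear_bound:
  fixes N :: "real^'n \<Rightarrow> real" and A :: "real \<Rightarrow> real^'n^'n"
  assumes N: "is_norm N" and ab: "a \<le> b" and "0 \<le> K"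
    and A: "continuous_on {a..b} A"
    and AK: "\<And>s v. s \<in> {a..b} \<Longrightarrow> N (A s *v v) \<le> K * N v"
    and h: "h integrable_on {a..b}" and k: "k integrable_on {a..b}"
    and hk: "\<And>s. s \<in> {a..b} \<Longrightarrow> N (h s) \<le> k s"
    and d: "continuous_on {a..b} d"
    and eq: "\<And>t. t \<in> {a..b} \<Longrightarrow> d t = integral {a..t} (\<lambda>s. A s *v d s + h s)"
  shows "N (d b) \<le> exp (K * (b - a)) * integral {a..b} k"
proof -
  have k0: "0 \<le> k s" if "s \<in> {a..b}" for s
    using hk[OF that] is_norm_nonneg[OF N, of "h s"] by linarith
  have Nd: "continuous_on {a..b} (\<lambda>s. N (d s))"
    using continuous_on_compose2[OF is_norm_continuous_on[OF N, of UNIV] d] by simp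
  have "N (d b) \<le> integral {a..b} k * exp (integral {a..b} (\<lambda>_. K))"
  proof (rule gronwall_integrable_kernel[OF ab])
    fix t
    assume t: "t \<in> {a..b}"
    have sub: "{a..t} \<subseteq> {a..b}"
      using t by auto
    have int: "(\<lambda>s. A s *v d s) integrable_on {a..t}" "h integrable_on {a..t}"
      "(\<lambda>s. K * N (d s)) integrable_on {a..t}" "k integrable_on {a..t}"
      using t sub
      by (auto intro!: integrable_continuous_real continuous_intros continuous_on_subset[OF Nd sub]
          bounded_bilinear.continuous_on[OF bounded_bilinear_matrix_vector_mult]
          continuous_on_subset[OF A sub] continuous_on_subset[OF d sub]
          integrable_subinterval_real[OF h] integrable_subinterval_real[OF k])
    have "N (d t) \<le> integral {a..t} (\<lambda>s. K * N (d s) + k s)"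
      unfolding eq[OF t]
    proof (rule is_norm_integral_le[OF N])
      fix s
      assume "s \<in> {a..t}"
      then show "N (A s *v d s + h s) \<le> K * N (d s) + k s"
        using is_norm_triangle[OF N, of "A s *v d s" "h s"] AK[of s "d s"] hk[of s] sub by fastforce
    qed (use int in \<open>auto intro: integrable_add\<close>)
    also have "\<dots> = integral {a..t} (\<lambda>s. K * N (d s)) + integral {a..t} k"
      using int by (intro integral_add)
    also have "integral {a..t} k \<le> integral {a..b} k"
      using t k0 k int by (intro integral_subset_le) auto
    finally show "N (d t) \<le> integral {a..b} k + integral {a..t} (\<lambda>s. K * N (d s))"
      by simp
  qed (use k k0 Nd \<open>0 \<le> K\<close> is_norm_nonneg[OF N] in
      \<open>auto intro!: integral_nonneg integrable_continuous_real continuous_intros\<close>)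
  then show ?thesis
    using ab by (simp add: mult.commute)
qed

lemma continuous_matrix_uniform_bound:
  fixes N :: "real^'n \<Rightarrow> real" and A :: "real \<Rightarrow> real^'n^'n"
  assumes "is_norm N" "continuous_on {a..b} A"
  shows "\<exists>K\<ge>0. \<forall>s\<in>{a..b}. \<forall>v. N (A s *v v) \<le> K * N v"
proof -
  obtain C where C: "C > 0" "\<And>(M :: real^'n^'n) v. N (M *v v) \<le> C * norm M * N v"
    using is_norm_matrix_vector_bound[OF assms(1)] by blast
  have "bounded (A ` {a..b})"
    using assms(2) by (intro compact_imp_bounded compact_continuous_image) auto
  then obtain B where B: "B > 0" "\<And>s. s \<in> {a..b} \<Longrightarrow> norm (A s) \<le> B"
    unfolding bounded_pos by auto
  have "N (A s *v v) \<le> (C * B) * N v" if "s \<in> {a..b}" for s v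
  proof -
    have "C * norm (A s) * N v \<le> C * B * N v"
      using B(2)[OF that] C(1) is_norm_nonneg[OF assms(1), of v]
      by (intro mult_right_mono mult_left_mono) auto
    with C(2)[of "A s" v] show ?thesis
      by linarith
  qed
  with B(1) C(1) show ?thesis
    by (intro exI[of _ "C * B"]) auto
qed

section \<open>The transition matrix and variation of constants\<close>

context
  fixes A :: "real \<Rightarrow> real^'n^'n" and R :: "real \<Rightarrow> real \<Rightarrow> real^'n^'n"
  assumes A: "continuous_on {0..} A" and R: "transition_matrix A R"
begin

lemma transition_matrix_self: "0 \<le> t0 \<Longrightarrow> R t0 t0 = mat 1"
  using R unfolding transition_matrix_def by auto

lemma transition_matrix_vector_derivative:
  assumes "0 \<le> t0" "0 \<le> t"
  shows "((\<lambda>s. R s t0 *v v) has_vector_derivative A t *v (R t t0 *v v)) (at t within {0..})"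
proof -
  have "((\<lambda>s. R s t0) has_vector_derivative A t ** R t t0) (at t within {0..})"
    using R assms unfolding transition_matrix_def by auto
  from bounded_linear.has_vector_derivative
    [OF bounded_bilinear.bounded_linear_left[OF bounded_bilinear_matrix_vector_mult] this]
  show ?thesis
    by (simp add: matrix_vector_mul_assoc)
qed

lemma transition_matrix_continuous_on:
  assumes "0 \<le> t0" "0 \<le> a"
  shows "continuous_on {a..b} (\<lambda>s. R s t0 *v v)"
proof (rule continuous_on_subset)
  show "continuous_on {0..} (\<lambda>s. R s t0 *v v)"
    using transition_matrix_vector_derivative[OF assms(1)]
    by (intro continuous_on_vector_derivative) auto
qed (use assms in auto)

lemma transition_matrix_integral_eq:
  assumes "0 \<le> t0" "0 \<le> a" "a \<le> t"
  shows "integral {a..t} (\<lambda>s. A s *v (R s t0 *v v)) = R t t0 *v v - R a t0 *v v"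
proof (intro integral_unique fundamental_theorem_of_calculus[OF assms(3)])
  fix s
  assume "s \<in> {a..t}"
  then show "((\<lambda>s. R s t0 *v v) has_vector_derivative A s *v (R s t0 *v v)) (at s within {a..t})"
    using assms(1,2)
    by (intro has_vector_derivative_within_subset[OF transition_matrix_vector_derivative]) auto
qed

text \<open>\<open>x - R(\<cdot>,s) x(s)\<close> solves the forced equation with zero initial value.\<close>

lemma forced_deviation_bound:
  fixes N :: "real^'n \<Rightarrow> real"
  assumes N: "is_norm N" and "0 \<le> a" "a \<le> b" "0 \<le> K"
    and AK: "\<And>s v. s \<in> {a..b} \<Longrightarrow> N (A s *v v) \<le> K * N v"
    and h: "h integrable_on {a..b}" and k: "k integrable_on {a..b}"
    and hk: "\<And>s. s \<in> {a..b} \<Longrightarrow> N (h s) \<le> k s"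
    and x: "continuous_on {a..b} x"
    and eq: "\<And>t. t \<in> {a..b} \<Longrightarrow> x t = x a + integral {a..t} (\<lambda>s. A s *v x s + h s)"
  shows "N (x b - R b a *v x a) \<le> exp (K * (b - a)) * integral {a..b} k"
proof (rule forced_linear_bound[OF N \<open>a \<le> b\<close> \<open>0 \<le> K\<close> _ AK h k hk])
  show cA: "continuous_on {a..b} A"
    using A by (rule continuous_on_subset) (use \<open>0 \<le> a\<close> in auto)
  have cR: "continuous_on {a..b} (\<lambda>s. R s a *v x a)"
    using \<open>0 \<le> a\<close> by (intro transition_matrix_continuous_on)
  show "continuous_on {a..b} (\<lambda>s. x s - R s a *v x a)"
    by (intro continuous_on_diff x cR)
  fix t
  assume t: "t \<in> {a..b}"
  have sub: "{a..t} \<subseteq> {a..b}"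
    using t by auto
  have int: "(\<lambda>s. A s *v x s) integrable_on {a..t}" "h integrable_on {a..t}"
    "(\<lambda>s. A s *v (R s a *v x a)) integrable_on {a..t}"
    using t
    by (auto intro!: integrable_continuous_real integrable_subinterval_real[OF h]
        bounded_bilinear.continuous_on[OF bounded_bilinear_matrix_vector_mult]
        continuous_on_subset[OF cA sub] continuous_on_subset[OF x sub] continuous_on_subset[OF cR sub])
  have "integral {a..t} (\<lambda>s. A s *v (x s - R s a *v x a) + h s) =
      integral {a..t} (\<lambda>s. (A s *v x s + h s) - A s *v (R s a *v x a))"
    by (intro integral_cong) (simp add: matrix_vector_mult_diff_distrib)
  also have "\<dots> = (x t - x a) - (R t a *v x a - R a a *v x a)"
    using t eq[OF t] transition_matrix_integral_eq[of a a t "x a"] \<open>0 \<le> a\<close> int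
    by (subst integral_diff) (auto intro: integrable_add)
  finally show "x t - R t a *v x a = integral {a..t} (\<lambda>s. A s *v (x s - R s a *v x a) + h s)"
    using \<open>0 \<le> a\<close> by (simp add: transition_matrix_self)
qed auto

text \<open>Uniqueness: from time \<open>s\<close> on,
  \<open>\<lambda>\<tau>. R \<tau> r *v v\<close> solves the homogeneous equation, and its deviation
  from the solution propagated by \<open>R \<tau> s\<close> is bounded by the integral of a zero
  forcing.\<close>

lemma transition_matrix_cocycle:
  assumes "0 \<le> r" "0 \<le> s" "s \<le> t"
  shows "R t s *v (R s r *v v) = R t r *v v"
proof -
  have "continuous_on {s..t} A"
    using A by (rule continuous_on_subset) (use assms in auto)
  then obtain K where K: "0 \<le> K" "\<And>\<tau> v. \<tau> \<in> {s..t} \<Longrightarrow> norm (A \<tau> *v v) \<le> K * norm v"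
    using continuous_matrix_uniform_bound[OF is_norm_norm] by metis
  have "norm (R t r *v v - R t s *v (R s r *v v)) \<le> exp (K * (t - s)) * integral {s..t} (\<lambda>_. 0)"
    using assms
    by (intro forced_deviation_bound[OF is_norm_norm _ _ K, where h = "\<lambda>_. 0" and k = "\<lambda>_. 0"
          and x = "\<lambda>\<tau>. R \<tau> r *v v"] transition_matrix_continuous_on) (auto simp: transition_matrix_integral_eq)
  then show ?thesis
    by simp
qed

text \<open>The variation-of-constants estimate, without differentiating \<open>R(t,s)\<close> in \<open>s\<close>: by the
  cocycle identity the increments of \<open>s \<mapsto> R(t,s) x(s)\<close> are \<open>R(t,s2)\<close> applied to the
  deviation of \<open>x\<close> on \<open>[s1,s2]\<close>.\<close>

lemma variation_of_constants_bound:
  fixes N :: "real^'n \<Rightarrow> real" and x :: "real \<Rightarrow> real^'n"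
  assumes N: "is_norm N" and "0 \<le> c" "0 \<le> \<gamma>" "0 \<le> a" "a \<le> b"
    and decay: "\<And>t t0. 0 \<le> t0 \<Longrightarrow> t0 \<le> t \<Longrightarrow> induced_norm N (R t t0) \<le> c * exp (- \<gamma> * (t - t0))"
    and h: "h integrable_on {a..b}" and k: "k integrable_on {a..b}"
    and hk: "\<And>s. s \<in> {a..b} \<Longrightarrow> N (h s) \<le> k s"
    and x: "continuous_on {a..b} x"
    and eq: "\<And>t. t \<in> {a..b} \<Longrightarrow> x t = x a + integral {a..t} (\<lambda>s. A s *v x s + h s)"
  shows "N (x b) \<le> c * exp (- \<gamma> * (b - a)) * N (x a)
    + c * integral {a..b} (\<lambda>s. exp (- \<gamma> * (b - s)) * k s)"
proof -
  have Rbound: "N (R t s *v v) \<le> c * exp (- \<gamma> * (t - s)) * N v" if "0 \<le> s" "s \<le> t" for s t v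
    using induced_norm_bound[OF N, of "R t s" v]
      mult_right_mono[OF decay[OF that] is_norm_nonneg[OF N, of v]] by linarith
  have k0: "0 \<le> k s" if "s \<in> {a..b}" for s
    using hk[OF that] is_norm_nonneg[OF N, of "h s"] by linarith
  have cA: "continuous_on {a..b} A"
    using A by (rule continuous_on_subset) (use \<open>0 \<le> a\<close> in auto)
  then obtain K where K: "0 \<le> K" "\<And>s v. s \<in> {a..b} \<Longrightarrow> N (A s *v v) \<le> K * N v"
    using continuous_matrix_uniform_bound[OF N] by metis
  define m where "m = (\<lambda>s. exp (- \<gamma> * (b - s)) * k s)"
  have m: "m integrable_on {a..b}"
    unfolding m_def using k k0
    by (intro integrable_continuous_times_nonneg) (auto intro!: continuous_intros)
  have intAh: "(\<lambda>s. A s *v x s + h s) integrable_on {a..b}"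
    by (intro integrable_add integrable_continuous_real h
        bounded_bilinear.continuous_on[OF bounded_bilinear_matrix_vector_mult] cA x)
  define D where "D = N (x b - R b a *v x a)"
  \<comment> \<open>The factor \<open>l\<close> absorbs two errors on a short interval
    \<open>{s..t}\<close>: the growth \<open>exp (K * (t - s))\<close> of the deviation and the
    variation \<open>exp (\<gamma> * (t - s))\<close> of the exponential weight.\<close>
  have *: "D \<le> l * (c * integral {a..b} m)" if l: "l > 1" for l
  proof -
    \<comment> \<open>This length ensures \<open>exp ((K + \<gamma>) * (t - s)) \<le> l\<close>; the
      \<open>+ 1\<close> keeps the denominator positive when \<open>K\<close> and \<gamma> are both
      zero.\<close>
    define \<delta> where "\<delta> = ln l / (K + \<gamma> + 1)"
    have "\<delta> > 0"
      unfolding \<delta>_def using l K(1) \<open>0 \<le> \<gamma>\<close> by (intro divide_pos_pos) auto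
    \<comment> \<open>\<open>f\<close> vanishes at \<open>a\<close> and equals
      \<open>l * c * integral {a..b} m - D\<close> at \<open>b\<close>, so
      \<open>f a \<le> f b\<close> is the claim.\<close>
    define f where "f = (\<lambda>s. l * c * integral {a..s} m - N (R b s *v x s - R b a *v x a))"
    have "f a \<le> f b"
    proof (rule locally_increasing_imp_le[OF \<open>\<delta> > 0\<close> \<open>a \<le> b\<close>])
      fix s t
      assume st: "a \<le> s" "s \<le> t" "t \<le> b" "t - s \<le> \<delta>"
      have sub: "{s..t} \<subseteq> {a..b}" and s0: "0 \<le> s" "0 \<le> t"
        using st \<open>0 \<le> a\<close> by auto
      have int: "h integrable_on {s..t}" "k integrable_on {s..t}" "m integrable_on {s..t}"
        using h k m sub by (auto intro: integrable_subinterval_real)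
      have dev: "N (x t - R t s *v x s) \<le> exp (K * (t - s)) * integral {s..t} k"
      proof (rule forced_deviation_bound[OF N s0(1) st(2) K(1) _ int(1,2)])
        fix \<tau>
        assume \<tau>: "\<tau> \<in> {s..t}"
        then show "x \<tau> = x s + integral {s..\<tau>} (\<lambda>s. A s *v x s + h s)"
          using eq[of s] eq[of \<tau>] integral_diff_subinterval[OF intAh, of s \<tau>] st
          by (simp add: algebra_simps)
      qed (use sub K hk x in \<open>auto intro: continuous_on_subset\<close>)
      have "(K + \<gamma>) * (t - s) \<le> (K + \<gamma> + 1) * \<delta>"
        using K(1) \<open>0 \<le> \<gamma>\<close> st by (intro mult_mono) auto
      also have "\<dots> = ln l"
        unfolding \<delta>_def using K(1) \<open>0 \<le> \<gamma>\<close> by simp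
      finally have "exp ((K + \<gamma>) * (t - s)) \<le> l"
        using l by (simp add: ln_ge_iff)
      then have lbound: "exp (\<gamma> * (t - s)) * exp (K * (t - s)) \<le> l"
        by (simp add: exp_add[symmetric] algebra_simps)
      \<comment> \<open>Across \<open>{s..t}\<close> the weight in \<open>m\<close> falls below its
        value at \<open>t\<close> by a factor of at most
        \<open>exp (\<gamma> * (t - s))\<close>.\<close>
      have kint: "exp (- \<gamma> * (b - t)) * integral {s..t} k \<le> exp (\<gamma> * (t - s)) * integral {s..t} m"
      proof -
        have "integral {s..t} (\<lambda>r. exp (- \<gamma> * (b - t)) * k r) \<le>
            integral {s..t} (\<lambda>r. exp (\<gamma> * (t - s)) * m r)"
        proof (rule integral_le)
          fix r
          assume r: "r \<in> {s..t}"
          have "- \<gamma> * (b - t) \<le> \<gamma> * (t - s) + - \<gamma> * (b - r)"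
            using mult_left_mono[of s r \<gamma>] r \<open>0 \<le> \<gamma>\<close> by (simp add: algebra_simps)
          then have "exp (- \<gamma> * (b - t)) \<le> exp (\<gamma> * (t - s)) * exp (- \<gamma> * (b - r))"
            by (simp add: exp_add[symmetric])
          then have "exp (- \<gamma> * (b - t)) * k r \<le> exp (\<gamma> * (t - s)) * exp (- \<gamma> * (b - r)) * k r"
            using k0[of r] r sub by (intro mult_right_mono) auto
          then show "exp (- \<gamma> * (b - t)) * k r \<le> exp (\<gamma> * (t - s)) * m r"
            by (simp add: m_def mult.assoc)
        qed (use int in \<open>auto intro: integrable_on_mult_right\<close>)
        then show ?thesis
          by simp
      qed
      \<comment> \<open>The cocycle identity splits \<open>R b s\<close> through time
        \<open>t\<close>, so \<open>R b t\<close> factors out of the increment and contributes its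
        decay bound.\<close>
      have "R b t *v x t - R b s *v x s = R b t *v (x t - R t s *v x s)"
        using s0 st by (simp add: matrix_vector_mult_diff_distrib transition_matrix_cocycle)
      then have "N (R b t *v x t - R b s *v x s)
          \<le> c * exp (- \<gamma> * (b - t)) * N (x t - R t s *v x s)"
        using Rbound[of t b] s0 st by simp
      also have "\<dots> \<le> c * exp (- \<gamma> * (b - t)) * (exp (K * (t - s)) * integral {s..t} k)"
        using \<open>0 \<le> c\<close> by (intro mult_left_mono dev) auto
      also have "\<dots> = c * exp (K * (t - s)) * (exp (- \<gamma> * (b - t)) * integral {s..t} k)"
        by simp
      also have "\<dots> \<le> c * exp (K * (t - s)) * (exp (\<gamma> * (t - s)) * integral {s..t} m)"
        using \<open>0 \<le> c\<close> by (intro mult_left_mono kint) auto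
      also have "\<dots> = c * integral {s..t} m * (exp (\<gamma> * (t - s)) * exp (K * (t - s)))"
        by simp
      also have "\<dots> \<le> c * integral {s..t} m * l"
        using \<open>0 \<le> c\<close> int k0 sub
        by (intro mult_left_mono lbound mult_nonneg_nonneg integral_nonneg) (auto simp: m_def)
      also have "integral {s..t} m = integral {a..t} m - integral {a..s} m"
        using integral_diff_subinterval[OF m] st by simp
      finally have "N (R b t *v x t - R b s *v x s) \<le> l * c * integral {a..t} m - l * c * integral {a..s} m"
        by (simp add: algebra_simps)
      moreover have "N (R b t *v x t - R b a *v x a)
          \<le> N (R b t *v x t - R b s *v x s) + N (R b s *v x s - R b a *v x a)"
        using is_norm_triangle[OF N, of "R b t *v x t - R b s *v x s" "R b s *v x s - R b a *v x a"]
        by simp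
      ultimately show "f s \<le> f t"
        unfolding f_def by linarith
    qed
    then show ?thesis
      using \<open>0 \<le> a\<close> \<open>a \<le> b\<close>
      by (simp add: f_def D_def transition_matrix_self is_norm_zero[OF N])
  qed
  \<comment> \<open>The limit of \<open>l\<close> to 1, with \<open>z\<close> in the role of
    \<open>1 / l\<close>.\<close>
  have "D \<le> c * integral {a..b} m"
  proof (rule field_le_mult_one_interval)
    fix z :: real
    assume "0 < z" "z < 1"
    then show "z * D \<le> c * integral {a..b} m"
      using *[of "1 / z"] by (simp add: field_simps)
  qed
  moreover have "N (R b a *v x a) \<le> c * exp (- \<gamma> * (b - a)) * N (x a)"
    using Rbound \<open>0 \<le> a\<close> \<open>a \<le> b\<close> .
  moreover have "N (x b) \<le> D + N (R b a *v x a)"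
    using is_norm_triangle[OF N, of "x b - R b a *v x a" "R b a *v x a"] by (simp add: D_def)
  ultimately show ?thesis
    unfolding m_def by linarith
qed

end

subsection \<open>Stability of the perturbed system\<close>

lemma time_interval_subset: "t \<in> time_interval t0 T \<Longrightarrow> {t0..t} \<subseteq> time_interval t0 T"
  unfolding time_interval_def by (auto intro: le_less_trans[of "ereal _" "ereal t"])

lemma solution_exponential_bound:
  fixes N :: "real^'n \<Rightarrow> real" and A :: "real \<Rightarrow> real^'n^'n"
  assumes N: "is_norm N" and A: "continuous_on {0..} A" and R: "transition_matrix A R"
    and "0 \<le> c" "0 \<le> \<gamma>"
    and decay: "\<And>t t0. 0 \<le> t0 \<Longrightarrow> t0 \<le> t \<Longrightarrow> induced_norm N (R t t0) \<le> c * exp (- \<gamma> * (t - t0))"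
    and int: "\<phi> integrable_on {t0..t}"
    and nonneg: "\<And>s. 0 \<le> s \<Longrightarrow> 0 \<le> \<phi> s"
    and g: "\<And>s y. 0 \<le> s \<Longrightarrow> N (g s y) \<le> \<phi> s * N y"
    and sol: "is_solution A g t0 x0 T x" and "0 \<le> t0" and t: "t \<in> time_interval t0 T"
  shows "N (x t) \<le> c * N x0 * exp (c * integral {t0..t} \<phi> - \<gamma> * (t - t0))"
proof -
  have t0t: "t0 \<le> t"
    using t by (simp add: time_interval_def)
  note sub = time_interval_subset[OF t]
  have x: "continuous_on {t0..t} x"
    using sol sub unfolding is_solution_def by (auto intro: continuous_on_subset)
  have eq: "x s = x0 + integral {t0..s} (\<lambda>r. A r *v x r + g r (x r))" if "s \<in> {t0..t}" for s
    using sol sub that unfolding is_solution_def by blast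
  have x0: "x t0 = x0"
    using eq[of t0] t0t by simp
  have h: "(\<lambda>r. g r (x r)) integrable_on {t0..t}"
    using sol t unfolding is_solution_def by (blast intro: set_lebesgue_integral_eq_integral(1))
  have Nx: "continuous_on {t0..t} (\<lambda>s. N (x s))"
    using continuous_on_compose2[OF is_norm_continuous_on[OF N, of UNIV] x] by simp
  have k: "(\<lambda>s. \<phi> s * N (x s)) integrable_on {t0..t}"
    using integrable_continuous_times_nonneg[OF Nx int] nonneg \<open>0 \<le> t0\<close> by (simp add: mult.commute)
  \<comment> \<open>The weight cancels the decay rate, which leaves an integral inequality with
    kernel \<open>c * \<phi>\<close>.\<close>
  define u where "u = (\<lambda>s. exp (\<gamma> * (s - t0)) * N (x s))"
  have u: "continuous_on {t0..t} u"
    unfolding u_def by (intro continuous_intros Nx)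
  have "u t \<le> c * N x0 * exp (integral {t0..t} (\<lambda>s. c * \<phi> s))"
  proof (rule gronwall_integrable_kernel[OF t0t])
    show "(\<lambda>s. c * \<phi> s * u s) integrable_on {t0..t}"
      using integrable_on_mult_right[OF integrable_continuous_times_nonneg[OF u int], of c]
        nonneg \<open>0 \<le> t0\<close>
      by (simp add: mult_ac)
    fix s
    assume s: "s \<in> {t0..t}"
    have "N (x s) \<le> c * exp (- \<gamma> * (s - t0)) * N (x t0)
        + c * integral {t0..s} (\<lambda>r. exp (- \<gamma> * (s - r)) * (\<phi> r * N (x r)))"
    proof (rule variation_of_constants_bound[OF A R N \<open>0 \<le> c\<close> \<open>0 \<le> \<gamma>\<close> \<open>0 \<le> t0\<close> _ decay])
      show "(\<lambda>r. g r (x r)) integrable_on {t0..s}" "(\<lambda>r. \<phi> r * N (x r)) integrable_on {t0..s}"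
        "continuous_on {t0..s} x"
        using s
        by (auto intro: integrable_subinterval_real[OF h] integrable_subinterval_real[OF k]
            continuous_on_subset[OF x])
      show "x r = x t0 + integral {t0..r} (\<lambda>s. A s *v x s + g s (x s))" if "r \<in> {t0..s}" for r
        using eq[of r] that s by (auto simp: x0)
    qed (use s \<open>0 \<le> t0\<close> g in auto)
    then have "u s \<le> exp (\<gamma> * (s - t0)) * (c * exp (- \<gamma> * (s - t0)) * N (x t0)
        + c * integral {t0..s} (\<lambda>r. exp (- \<gamma> * (s - r)) * (\<phi> r * N (x r))))"
      unfolding u_def by (intro mult_left_mono) auto
    also have "\<dots> = (exp (\<gamma> * (s - t0)) * exp (- \<gamma> * (s - t0))) * (c * N x0)
        + integral {t0..s} (\<lambda>r. exp (\<gamma> * (s - t0)) * (c * (exp (- \<gamma> * (s - r)) * (\<phi> r * N (x r)))))"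
      unfolding x0 integral_mult_right by (simp add: distrib_left mult_ac)
    also have "exp (\<gamma> * (s - t0)) * exp (- \<gamma> * (s - t0)) = 1"
      by (simp add: exp_add[symmetric])
    also have "integral {t0..s} (\<lambda>r. exp (\<gamma> * (s - t0)) * (c * (exp (- \<gamma> * (s - r)) * (\<phi> r * N (x r)))))
        = integral {t0..s} (\<lambda>r. c * \<phi> r * u r)"
    proof (rule integral_cong)
      fix r
      have "exp (\<gamma> * (r - t0)) = exp (\<gamma> * (s - t0)) * exp (- \<gamma> * (s - r))"
        by (simp add: exp_add[symmetric] algebra_simps)
      then show "exp (\<gamma> * (s - t0)) * (c * (exp (- \<gamma> * (s - r)) * (\<phi> r * N (x r)))) = c * \<phi> r * u r"
        by (simp add: u_def mult_ac)
    qed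
    finally show "u s \<le> c * N x0 + integral {t0..s} (\<lambda>r. c * \<phi> r * u r)"
      by simp
  qed (use int nonneg \<open>0 \<le> t0\<close> \<open>0 \<le> c\<close> is_norm_nonneg[OF N] in
      \<open>auto intro: integrable_on_mult_right simp: u_def\<close>)
  then have "exp (- \<gamma> * (t - t0)) * u t
      \<le> exp (- \<gamma> * (t - t0)) * (c * N x0 * exp (c * integral {t0..t} \<phi>))"
    by (intro mult_left_mono) auto
  also have "exp (- \<gamma> * (t - t0)) * u t = N (x t)"
    unfolding u_def by (simp add: mult.assoc[symmetric] exp_add[symmetric])
  also have "exp (- \<gamma> * (t - t0)) * (c * N x0 * exp (c * integral {t0..t} \<phi>))
      = c * N x0 * exp (c * integral {t0..t} \<phi> - \<gamma> * (t - t0))"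
    unfolding diff_conv_add_uminus[of "c * integral {t0..t} \<phi>"] exp_add by (simp add: mult_ac)
  finally show ?thesis .
qed

text \<open>Common end of both cases. The slope \<epsilon> of the integral bound costs
  \<open>c * \<epsilon>\<close> of the decay rate and the offset \<open>M\<close> costs a factor
  \<open>exp (c * M)\<close>, so that \<open>C = c * exp (c * M)\<close> and
  \<open>\<mu> = \<gamma> - c * \<epsilon>\<close>.\<close>

lemma exponentially_stable_of_mean_bound:
  fixes N :: "real^'n \<Rightarrow> real" and A :: "real \<Rightarrow> real^'n^'n"
  assumes N: "is_norm N" and A: "continuous_on {0..} A" and R: "transition_matrix A R"
    and cont: "continuation_property A g"
    and c: "0 < c" and "0 < \<gamma>"
    and decay: "\<And>t t0. 0 \<le> t0 \<Longrightarrow> t0 \<le> t \<Longrightarrow> induced_norm N (R t t0) \<le> c * exp (- \<gamma> * (t - t0))"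
    and int: "\<And>a b. 0 \<le> a \<Longrightarrow> \<phi> integrable_on {a..b}"
    and mean: "\<And>a b. 0 \<le> a \<Longrightarrow> a \<le> b \<Longrightarrow> integral {a..b} \<phi> \<le> M + \<epsilon> * (b - a)"
    and eps: "c * \<epsilon> < \<gamma>"
    and nonneg: "\<And>s. 0 \<le> s \<Longrightarrow> 0 \<le> \<phi> s"
    and g: "\<And>s y. 0 \<le> s \<Longrightarrow> N (g s y) \<le> \<phi> s * N y"
  shows "globally_uniformly_exponentially_stable N A g"
proof -
  have bound: "N (x t) \<le> c * exp (c * M) * N x0 * exp (- (\<gamma> - c * \<epsilon>) * (t - t0))"
    if sol: "is_solution A g t0 x0 T x" and t0: "0 \<le> t0" and t: "t \<in> time_interval t0 T"
    for t0 x0 T x t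
  proof -
    have "t0 \<le> t"
      using t by (simp add: time_interval_def)
    then have "c * integral {t0..t} \<phi> \<le> c * (M + \<epsilon> * (t - t0))"
      using mean[OF t0] c by (intro mult_left_mono) auto
    then have "c * integral {t0..t} \<phi> - \<gamma> * (t - t0) \<le> c * M + - (\<gamma> - c * \<epsilon>) * (t - t0)"
      by (simp add: algebra_simps)
    then have "exp (c * integral {t0..t} \<phi> - \<gamma> * (t - t0)) \<le> exp (c * M) * exp (- (\<gamma> - c * \<epsilon>) * (t - t0))"
      by (simp add: exp_add[symmetric])
    then have "c * N x0 * exp (c * integral {t0..t} \<phi> - \<gamma> * (t - t0))
        \<le> c * N x0 * (exp (c * M) * exp (- (\<gamma> - c * \<epsilon>) * (t - t0)))"
      using c is_norm_nonneg[OF N, of x0] by (intro mult_left_mono) auto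
    moreover have "N (x t) \<le> c * N x0 * exp (c * integral {t0..t} \<phi> - \<gamma> * (t - t0))"
      using c \<open>0 < \<gamma>\<close>
      by (intro solution_exponential_bound[OF N A R _ _ decay int[OF t0] nonneg g sol t0 t]) auto
    ultimately show ?thesis
      by (simp add: mult_ac)
  qed
  \<comment> \<open>The estimate holds on the whole existence interval, so a finite \<open>T\<close>
    would give a bounded noncontinuable solution, against \<open>continuation_property\<close>.
    Boundedness there is Euclidean, which calls for \<open>is_norm_lower_bound\<close>.\<close>
  have global: "T = \<infinity>" if "noncontinuable_solution A g t0 x0 T x" "0 \<le> t0" for t0 x0 T x
  proof (rule ccontr)
    assume "T \<noteq> \<infinity>"
    then have unbdd: "\<not> bounded (x ` time_interval t0 T)"
      using cont that unfolding continuation_property_def by auto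
    have sol: "is_solution A g t0 x0 T x"
      using that unfolding noncontinuable_solution_def by auto
    obtain D where D: "D > 0" "\<And>y. norm y \<le> D * N y"
      using is_norm_lower_bound[OF N] by blast
    have "norm (x t) \<le> D * (c * exp (c * M) * N x0)" if t: "t \<in> time_interval t0 T" for t
    proof -
      have "(\<gamma> - c * \<epsilon>) * (t - t0) \<ge> 0"
        using eps t by (auto simp: time_interval_def)
      then have "exp (- (\<gamma> - c * \<epsilon>) * (t - t0)) \<le> 1"
        by (subst exp_le_one_iff) linarith
      then have "c * exp (c * M) * N x0 * exp (- (\<gamma> - c * \<epsilon>) * (t - t0)) \<le> c * exp (c * M) * N x0 * 1"
        using c is_norm_nonneg[OF N, of x0] by (intro mult_left_mono) auto
      then have "N (x t) \<le> c * exp (c * M) * N x0"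
        using bound[OF sol \<open>0 \<le> t0\<close> t] by simp
      then have "D * N (x t) \<le> D * (c * exp (c * M) * N x0)"
        using D(1) by (intro mult_left_mono) auto
      with D(2)[of "x t"] show ?thesis
        by linarith
    qed
    then have "bounded (x ` time_interval t0 T)"
      unfolding bounded_iff by blast
    with unbdd show False
      by simp
  qed
  show ?thesis
    unfolding globally_uniformly_exponentially_stable_def
  proof (rule exI[of _ "c * exp (c * M)"], rule conjI, goal_cases)
    case 2
    show ?case
    proof (rule exI[of _ "\<gamma> - c * \<epsilon>"], intro conjI allI impI)
      fix t0 :: real and x0 T x t
      assume "0 \<le> t0" and sol: "noncontinuable_solution A g t0 x0 T x"
      then show "T = \<infinity>"
        by (rule global[rotated])
      assume "t0 \<le> t"
      with \<open>T = \<infinity>\<close> sol \<open>0 \<le> t0\<close>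
      show "N (x t) \<le> c * exp (c * M) * N x0 * exp (- (\<gamma> - c * \<epsilon>) * (t - t0))"
        by (intro bound) (auto simp: noncontinuable_solution_def time_interval_def)
    qed (use eps in auto)
  qed (use c in auto)
qed

text \<open>The part \<psi> contributes at most its total mass on any interval, and \<epsilon>
  contributes the slope. Domination is asked only almost everywhere, since an essential supremum
  gives no more.\<close>

lemma local_integral_bound:
  fixes \<phi> \<psi> :: "real \<Rightarrow> real"
  assumes meas: "\<phi> \<in> borel_measurable (lebesgue_on {0..})"
    and nonneg: "\<And>t. 0 \<le> t \<Longrightarrow> 0 \<le> \<phi> t"
    and \<psi>: "integrable (lebesgue_on {0..}) \<psi>" "\<And>t. 0 \<le> \<psi> t"
    and le: "AE t in lebesgue_on {0..}. \<phi> t \<le> \<psi> t + \<epsilon>"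
    and "0 \<le> a"
  shows "\<phi> integrable_on {a..b}"
    and "a \<le> b \<Longrightarrow> integral {a..b} \<phi> \<le> integral\<^sup>L (lebesgue_on {0..}) \<psi> + \<epsilon> * (b - a)"
proof -
  have sub: "{a..b} \<subseteq> {0..}"
    using \<open>0 \<le> a\<close> by auto
  have ae: "AE t in lebesgue_on {a..b}. \<phi> t \<le> \<psi> t + \<epsilon>"
    using le sub by (subst AE_restrict_space_iff; force simp: AE_restrict_space_iff elim: eventually_mono)
  have \<psi>_abs: "\<psi> absolutely_integrable_on {0..}"
    using \<psi>(1) by (simp add: absolutely_integrable_on_iff_nonneg integrable_on_lebesgue_on
        nonnegative_absolutely_integrable_1 \<psi>(2))
  have \<psi>_ab: "integrable (lebesgue_on {a..b}) \<psi>"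
    using set_integrable_subset[OF \<psi>_abs _ sub] by (simp add: set_integrable_def integrable_restrict_space)
  have bound_int: "integrable (lebesgue_on {a..b}) (\<lambda>t. \<psi> t + \<epsilon>)"
    using \<psi>_ab by (intro Bochner_Integration.integrable_add) auto
  have \<phi>: "integrable (lebesgue_on {a..b}) \<phi>"
  proof (rule Bochner_Integration.integrable_bound[OF bound_int])
    show "\<phi> \<in> borel_measurable (lebesgue_on {a..b})"
      using meas sub by (rule measurable_restrict_mono)
    show "AE t in lebesgue_on {a..b}. norm (\<phi> t) \<le> norm (\<psi> t + \<epsilon>)"
      using ae AE_space
    proof eventually_elim
      case (elim t)
      then show ?case
        using nonneg[of t] sub by auto
    qed
  qed
  then show "\<phi> integrable_on {a..b}"
    by (rule integrable_on_lebesgue_on) auto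
  assume "a \<le> b"
  have "integral {a..b} \<phi> = integral\<^sup>L (lebesgue_on {a..b}) \<phi>"
    using \<phi> by (simp add: lebesgue_integral_eq_integral)
  also have "\<dots> \<le> integral\<^sup>L (lebesgue_on {a..b}) (\<lambda>t. \<psi> t + \<epsilon>)"
    using \<phi> bound_int ae by (rule integral_mono_AE)
  also have "\<dots> = integral\<^sup>L (lebesgue_on {a..b}) \<psi> + \<epsilon> * (b - a)"
    using \<psi>_ab \<open>a \<le> b\<close> by (simp add: measure_restrict_space)
  also have "integral\<^sup>L (lebesgue_on {a..b}) \<psi> = integral {a..b} \<psi>"
    using \<psi>_ab by (simp add: lebesgue_integral_eq_integral)
  \<comment> \<open>Since \<psi> is nonnegative, the interval may grow to the half-line, which makes
    the constant independent of \<open>a\<close> and \<open>b\<close>.\<close>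
  also have "\<dots> \<le> integral {0..} \<psi>"
    using \<psi> \<psi>_ab sub by (intro integral_subset_le) (auto intro: integrable_on_lebesgue_on)
  also have "integral {0..} \<psi> = integral\<^sup>L (lebesgue_on {0..}) \<psi>"
    using \<psi>(1) by (simp add: lebesgue_integral_eq_integral)
  finally show "integral {a..b} \<phi> \<le> integral\<^sup>L (lebesgue_on {0..}) \<psi> + \<epsilon> * (b - a)"
    by simp
qed

text \<open>Replaces Hoelder's inequality: where \<open>y > \<epsilon>\<close>, \<open>y = y powr p * y powr (1 - p)\<close> and the last
  factor is at most \<open>\<epsilon> powr (1 - p)\<close>.\<close>

lemma le_powr_plus:
  fixes y \<epsilon> p :: real
  assumes "0 < \<epsilon>" "1 \<le> p"
  shows "y \<le> \<epsilon> powr (1 - p) * \<bar>y\<bar> powr p + \<epsilon>"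
proof (cases "y \<le> \<epsilon>")
  case True
  moreover have "0 \<le> \<epsilon> powr (1 - p) * \<bar>y\<bar> powr p"
    by simp
  ultimately show ?thesis
    by linarith
next
  case False
  then have y: "\<epsilon> < y" "0 < y"
    using assms by auto
  then have "y = y powr (1 - p) * y powr p"
    by (simp add: powr_add[symmetric])
  also have "\<dots> \<le> \<epsilon> powr (1 - p) * y powr p"
    using y assms by (intro mult_right_mono powr_mono2') auto
  finally show ?thesis
    using y assms by simp
qed

theorem theorem3p1:
  fixes N :: "real^'n \<Rightarrow> real"
    and A :: "real \<Rightarrow> real^'n^'n"
    and R :: "real \<Rightarrow> real \<Rightarrow> real^'n^'n"
    and g :: "real \<Rightarrow> real^'n \<Rightarrow> real^'n"
    and c \<gamma> :: real
  assumes "is_norm N"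
    and "continuous_on {0..} A"
    and "\<And>t. 0 \<le> t \<Longrightarrow> g t 0 = 0"
    and "continuation_property A g"
    and "uniformly_asymptotically_stable N A"
    and "transition_matrix A R"
    and "0 < c" and "0 < \<gamma>"
    and "\<And>t t0. 0 \<le> t0 \<Longrightarrow> t0 \<le> t \<Longrightarrow> induced_norm N (R t t0) \<le> c * exp (- \<gamma> * (t - t0))"
  shows "((\<exists>p \<phi>. 1 \<le> p \<and> Lp_nonneg p \<phi> \<and> (\<forall>t\<ge>0. \<forall>x. N (g t x) \<le> \<phi> t * N x))
            \<longrightarrow> globally_uniformly_exponentially_stable N A g) \<and>
         ((\<exists>\<phi>. Linf_nonneg \<phi> \<and> (\<forall>t\<ge>0. \<forall>x. N (g t x) \<le> \<phi> t * N x) \<and>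
               Linf_norm \<phi> < ereal (\<gamma> / c))
            \<longrightarrow> globally_uniformly_exponentially_stable N A g)"
proof -
  \<comment> \<open>Both cases reduce to splitting the bound on \<phi> into an integrable \<psi> and
    a constant \<epsilon> below \<open>\<gamma> / c\<close>.\<close>
  have main: "globally_uniformly_exponentially_stable N A g"
    if meas: "\<phi> \<in> borel_measurable (lebesgue_on {0..})" and nonneg: "\<forall>t\<ge>0. 0 \<le> \<phi> t"
      and \<psi>: "integrable (lebesgue_on {0..}) \<psi>" "\<And>t. 0 \<le> \<psi> t"
      and le: "AE t in lebesgue_on {0..}. \<phi> t \<le> \<psi> t + \<epsilon>"
      and \<epsilon>: "\<epsilon> < \<gamma> / c" and g: "\<forall>t\<ge>0. \<forall>x. N (g t x) \<le> \<phi> t * N x"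
    for \<phi> \<psi> :: "real \<Rightarrow> real" and \<epsilon>
  proof (rule exponentially_stable_of_mean_bound[OF assms(1,2,6,4,7,8,9)])
    show "c * \<epsilon> < \<gamma>"
      using \<epsilon> \<open>0 < c\<close> by (simp add: field_simps)
    show "\<phi> integrable_on {a..b}" if "0 \<le> a" for a b
      using local_integral_bound(1)[OF meas _ \<psi> le that] nonneg by blast
    show "integral {a..b} \<phi> \<le> integral\<^sup>L (lebesgue_on {0..}) \<psi> + \<epsilon> * (b - a)"
      if "0 \<le> a" "a \<le> b" for a b
      using local_integral_bound(2)[OF meas _ \<psi> le that] nonneg by blast
  qed (use nonneg g in auto)
  show ?thesis
  proof (intro conjI impI; elim exE conjE)
    fix p \<phi>
    assume p: "1 \<le> p" and \<phi>: "Lp_nonneg p \<phi>" and g: "\<forall>t\<ge>0. \<forall>x. N (g t x) \<le> \<phi> t * N x"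
    \<comment> \<open>Any positive number below \<open>\<gamma> / c\<close> would serve; this one
      leaves the decay rate \<open>\<gamma> / 2\<close>.\<close>
    define \<epsilon> where "\<epsilon> = \<gamma> / (2 * c)"
    have \<epsilon>: "0 < \<epsilon>" "\<epsilon> < \<gamma> / c"
      unfolding \<epsilon>_def using \<open>0 < c\<close> \<open>0 < \<gamma>\<close> by (auto simp: field_simps)
    show "globally_uniformly_exponentially_stable N A g"
      using \<phi> \<epsilon> p g le_powr_plus[OF \<epsilon>(1) p]
      by (intro main[where \<phi> = \<phi> and \<psi> = "\<lambda>t. \<epsilon> powr (1 - p) * \<bar>\<phi> t\<bar> powr p" and \<epsilon> = \<epsilon>])
        (auto simp: Lp_nonneg_def)
  next
    fix \<phi>
    assume \<phi>: "Linf_nonneg \<phi>" and g: "\<forall>t\<ge>0. \<forall>x. N (g t x) \<le> \<phi> t * N x"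
      and lt: "Linf_norm \<phi> < ereal (\<gamma> / c)"
    \<comment> \<open>The strict inequality leaves room for a real \<epsilon> in between, which
      bounds \<phi> almost everywhere, so \<open>\<psi> = 0\<close> suffices.\<close>
    then obtain \<epsilon> where \<epsilon>: "Linf_norm \<phi> < ereal \<epsilon>" "\<epsilon> < \<gamma> / c"
      using ereal_dense2[OF lt] by auto
    have "AE t in lebesgue_on {0..}. ereal \<bar>\<phi> t\<bar> \<le> Linf_norm \<phi>"
      unfolding Linf_norm_def by (rule esssup_AE)
    then have "AE t in lebesgue_on {0..}. \<phi> t \<le> 0 + \<epsilon>"
    proof eventually_elim
      case (elim t)
      then have "ereal \<bar>\<phi> t\<bar> < ereal \<epsilon>"
        using \<epsilon>(1) by (rule le_less_trans)
      then show ?case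
        by simp
    qed
    with \<phi> \<epsilon>(2) g show "globally_uniformly_exponentially_stable N A g"
      by (intro main[where \<phi> = \<phi> and \<psi> = "\<lambda>_. 0" and \<epsilon> = \<epsilon>]) (auto simp: Linf_nonneg_def)
  qed
qed

end
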